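(* Let $(\mathfrak g,\pi=[\cdot,\cdot,\cdot],d_{\mathfrak g})$ be a differential 3-Lie algebra with weight $\lambda$. Let $n\ge 2$, let $\pi_i:\wedge^3\mathfrak g\to\mathfrak g$ be trilinear skew-symmetric maps and $\varphi_i:\mathfrak g\to\mathfrak g$ linear maps ($0\le i\le n-1$) with $\pi_0=\pi$, $\varphi_0=d_{\mathfrak g}$, and put $\pi_t=\sum_{i=0}^{n-1}t^i\pi_i$, $\varphi_t=\sum_{i=0}^{n-1}t^i\varphi_i$. If $(\pi_t,\varphi_t)$ generates a deformation of the differential 3-Lie algebra $(\mathfrak g,\pi,d_{\mathfrak g})$, then $(\pi_1,\varphi_1)$ is a 2-cocycle of $(\mathfrak g,d_{\mathfrak g})$ with coefficients in the adjoint representation.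
   Context: $k$ is a field of characteristic 0; all vector spaces are over $k$. A 3-Lie algebra is a vector space $\mathfrak g$ with a skew-symmetric trilinear bracket satisfying $[x_1,x_2,[y_1,y_2,y_3]]=[[x_1,x_2,y_1],y_2,y_3]+[y_1,[x_1,x_2,y_2],y_3]+[y_1,y_2,[x_1,x_2,y_3]]$. A differential 3-Lie algebra with weight $\lambda$ is a 3-Lie algebra with a linear map $d=d_{\mathfrak g}:\mathfrak g\to\mathfrak g$ such that $d[x_1,x_2,x_3]=[dx_1,x_2,x_3]+[x_1,dx_2,x_3]+[x_1,x_2,dx_3]+\lambda[dx_1,dx_2,x_3]+\lambda[x_1,dx_2,dx_3]+\lambda[dx_1,x_2,dx_3]+\lambda^2[dx_1,dx_2,dx_3]$. $(\pi_t,\varphi_t)$ generates a deformation if $(\mathfrak g[[t]],\pi_t,\varphi_t)$ (with $\pi_t,\varphi_t$ extended $k[[t]]$-linearly) is a differential 3-Lie algebra with weight $\lambda$, i.e. the defining identities hold as identities in the parameter $t$. The adjoint representation is $V=\mathfrak g$, $\rho(x,y)z=[x,y,z]$, $d_V=d_{\mathfrak g}$. Put $\hat\rho(x,y)=\rho(x,y)+\lambda(\rho(dx,y)+\rho(x,dy)+\lambda\rho(dx,dy))$. For $X=x_1\wedge x_2,Y=y_1\wedge y_2\in\wedge^2\mathfrak g$ put $[X,Y]_F=y_1\wedge[x_1,x_2,y_2]+[x_1,x_2,y_1]\wedge y_2$, $[X,z]=[x_1,x_2,z]$, $\rho(X)=\rho(x_1,x_2)$, and $f(X,z)=f(x_1,x_2,z)$.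 A 2-cochain is a pair $(f,g)$ with $f:\wedge^3\mathfrak g\to V$ and $g:\mathfrak g\to V$ linear; it is a 2-cocycle if $\partial f=0$ and $\partial_\lambda g+\delta f=0$, where, for $X_i=x_i\wedge y_i$, $(\partial f)(X_1,X_2,z)=-f([X_1,X_2]_F,z)-f(X_2,[X_1,z])+f(X_1,[X_2,z])+\rho(X_1)f(X_2,z)-\rho(X_2)f(X_1,z)-\rho(y_2,z)f(X_1,x_2)-\rho(z,x_2)f(X_1,y_2)$, $(\partial_\lambda g)(x,y,z)=-g([x,y,z])+\hat\rho(x,y)g(z)+\hat\rho(y,z)g(x)+\hat\rho(z,x)g(y)$, $(\delta f)(x,y,z)=f(dx,y,z)+f(x,dy,z)+f(x,y,dz)+\lambda(f(dx,dy,z)+f(x,dy,dz)+f(dx,y,dz))+\lambda^2f(dx,dy,dz)-d_Vf(x,y,z)$. *)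

theory Defs
  imports Complex_Main "HOL-Computational_Algebra.Formal_Power_Series"
begin

section \<open>Differential 3-Lie algebras\<close>

text \<open>
  Skew-symmetry is invariance up to sign under the two adjacent transpositions. The notions are
  stated over a commutative ring of scalars, so that they apply both to a vector space over
  \<open>k\<close> and to its power series over \<open>k[[t]]\<close>; over a field, \<open>module\<close> is \<open>vector_space\<close>.
\<close>

definition skew_trilinear ::
  "('r::comm_ring_1 \<Rightarrow> 'v::ab_group_add \<Rightarrow> 'v) \<Rightarrow> ('r \<Rightarrow> 'w::ab_group_add \<Rightarrow> 'w) \<Rightarrow>
   ('v \<Rightarrow> 'v \<Rightarrow> 'v \<Rightarrow> 'w) \<Rightarrow> bool" where
  "skew_trilinear s s' f \<longleftrightarrow>
     (\<forall>y z. module_hom s s' (\<lambda>x. f x y z)) \<and>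
     (\<forall>x z. module_hom s s' (\<lambda>y. f x y z)) \<and>
     (\<forall>x y. module_hom s s' (\<lambda>z. f x y z)) \<and>
     (\<forall>x y z. f y x z = - f x y z) \<and>
     (\<forall>x y z. f x z y = - f x y z)"

locale three_lie_algebra = module scale
  for scale :: "'r::comm_ring_1 \<Rightarrow> 'v::ab_group_add \<Rightarrow> 'v" +
  fixes br :: "'v \<Rightarrow> 'v \<Rightarrow> 'v \<Rightarrow> 'v"
  assumes bracket_skew_trilinear: "skew_trilinear scale scale br"
    and fundamental_identity:
      "br x1 x2 (br y1 y2 y3) =
         br (br x1 x2 y1) y2 y3 + br y1 (br x1 x2 y2) y3 + br y1 y2 (br x1 x2 y3)"

locale differential_three_lie_algebra = three_lie_algebra scale br
  for scale :: "'r::comm_ring_1 \<Rightarrow> 'v::ab_group_add \<Rightarrow> 'v"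
    and br :: "'v \<Rightarrow> 'v \<Rightarrow> 'v \<Rightarrow> 'v" +
  fixes lam :: 'r and d :: "'v \<Rightarrow> 'v"
  assumes differential_linear: "module_hom scale scale d"
    and differential_identity:
      "d (br x1 x2 x3) =
         br (d x1) x2 x3 + br x1 (d x2) x3 + br x1 x2 (d x3)
         + scale lam (br (d x1) (d x2) x3)
         + scale lam (br x1 (d x2) (d x3))
         + scale lam (br (d x1) x2 (d x3))
         + scale (lam\<^sup>2) (br (d x1) (d x2) (d x3))"


section \<open>2-cocycles\<close>

text \<open>
  Alternating forms on \<open>\<and>\<^sup>3 g\<close> are skew-symmetric functions of three arguments, and \<open>f\<close> on
  \<open>\<and>\<^sup>2 g \<times> g\<close> is determined by \<open>f(x \<and> y, z) = f(x, y, z)\<close>. The coboundary of \<open>f\<close> is written on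
  decomposable bivectors \<open>X\<^sub>i = x\<^sub>i \<and> y\<^sub>i\<close>; its first line is
  \<open>- f([X\<^sub>1, X\<^sub>2]\<^sub>F, z)\<close> with \<open>[X\<^sub>1, X\<^sub>2]\<^sub>F = x\<^sub>2 \<and> [x\<^sub>1, y\<^sub>1, y\<^sub>2] + [x\<^sub>1, y\<^sub>1, x\<^sub>2] \<and> y\<^sub>2\<close>.
\<close>

definition coboundary ::
  "('v \<Rightarrow> 'v \<Rightarrow> 'v \<Rightarrow> 'v) \<Rightarrow> ('v \<Rightarrow> 'v \<Rightarrow> 'w \<Rightarrow> 'w) \<Rightarrow>
   ('v \<Rightarrow> 'v \<Rightarrow> 'v \<Rightarrow> 'w) \<Rightarrow> 'v \<times> 'v \<Rightarrow> 'v \<times> 'v \<Rightarrow> 'v \<Rightarrow> 'w::ab_group_add" where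
  "coboundary br rho f = (\<lambda>(x1, y1) (x2, y2) z.
     - (f x2 (br x1 y1 y2) z + f (br x1 y1 x2) y2 z)
     - f x2 y2 (br x1 y1 z) + f x1 y1 (br x2 y2 z)
     + rho x1 y1 (f x2 y2 z) - rho x2 y2 (f x1 y1 z)
     - rho y2 z (f x1 y1 x2) - rho z x2 (f x1 y1 y2))"

definition rho_hat ::
  "('r \<Rightarrow> 'w \<Rightarrow> 'w) \<Rightarrow> 'r \<Rightarrow> ('v \<Rightarrow> 'v) \<Rightarrow> ('v \<Rightarrow> 'v \<Rightarrow> 'w \<Rightarrow> 'w) \<Rightarrow>
   'v \<Rightarrow> 'v \<Rightarrow> 'w \<Rightarrow> 'w::ab_group_add" where
  "rho_hat scaleV lam d rho x y w =
     rho x y w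
     + scaleV lam (rho (d x) y w + rho x (d y) w + scaleV lam (rho (d x) (d y) w))"

definition coboundary_weighted ::
  "('v \<Rightarrow> 'v \<Rightarrow> 'v \<Rightarrow> 'v) \<Rightarrow> ('v \<Rightarrow> 'v) \<Rightarrow> 'r \<Rightarrow> ('r \<Rightarrow> 'w \<Rightarrow> 'w) \<Rightarrow> ('v \<Rightarrow> 'v \<Rightarrow> 'w \<Rightarrow> 'w) \<Rightarrow>
   ('v \<Rightarrow> 'w) \<Rightarrow> 'v \<Rightarrow> 'v \<Rightarrow> 'v \<Rightarrow> 'w::ab_group_add" where
  "coboundary_weighted br d lam scaleV rho g x y z =
     - g (br x y z) + rho_hat scaleV lam d rho x y (g z)
     + rho_hat scaleV lam d rho y z (g x) + rho_hat scaleV lam d rho z x (g y)"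

definition delta ::
  "('v \<Rightarrow> 'v) \<Rightarrow> 'r::comm_ring_1 \<Rightarrow> ('r \<Rightarrow> 'w \<Rightarrow> 'w) \<Rightarrow> ('w \<Rightarrow> 'w) \<Rightarrow>
   ('v \<Rightarrow> 'v \<Rightarrow> 'v \<Rightarrow> 'w) \<Rightarrow> 'v \<Rightarrow> 'v \<Rightarrow> 'v \<Rightarrow> 'w::ab_group_add" where
  "delta d lam scaleV dV f x y z =
     f (d x) y z + f x (d y) z + f x y (d z)
     + scaleV lam (f (d x) (d y) z + f x (d y) (d z) + f (d x) y (d z))
     + scaleV (lam\<^sup>2) (f (d x) (d y) (d z)) - dV (f x y z)"

definition two_cochain ::
  "('r::comm_ring_1 \<Rightarrow> 'v::ab_group_add \<Rightarrow> 'v) \<Rightarrow> ('r \<Rightarrow> 'w::ab_group_add \<Rightarrow> 'w) \<Rightarrow>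
   ('v \<Rightarrow> 'v \<Rightarrow> 'v \<Rightarrow> 'w) \<times> ('v \<Rightarrow> 'w) \<Rightarrow> bool" where
  "two_cochain scale scaleV = (\<lambda>(f, g).
     skew_trilinear scale scaleV f \<and> module_hom scale scaleV g)"

definition two_cocycle ::
  "('r::comm_ring_1 \<Rightarrow> 'v::ab_group_add \<Rightarrow> 'v) \<Rightarrow> ('v \<Rightarrow> 'v \<Rightarrow> 'v \<Rightarrow> 'v) \<Rightarrow> 'r \<Rightarrow> ('v \<Rightarrow> 'v) \<Rightarrow>
   ('r \<Rightarrow> 'w::ab_group_add \<Rightarrow> 'w) \<Rightarrow> ('v \<Rightarrow> 'v \<Rightarrow> 'w \<Rightarrow> 'w) \<Rightarrow> ('w \<Rightarrow> 'w) \<Rightarrow>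
   ('v \<Rightarrow> 'v \<Rightarrow> 'v \<Rightarrow> 'w) \<times> ('v \<Rightarrow> 'w) \<Rightarrow> bool" where
  "two_cocycle scale br lam d scaleV rho dV = (\<lambda>(f, g).
     two_cochain scale scaleV (f, g) \<and>
     (\<forall>X1 X2 z. coboundary br rho f X1 X2 z = 0) \<and>
     (\<forall>x y z. coboundary_weighted br d lam scaleV rho g x y z + delta d lam scaleV dV f x y z = 0))"

definition adjoint :: "('v \<Rightarrow> 'v \<Rightarrow> 'v \<Rightarrow> 'v) \<Rightarrow> 'v \<Rightarrow> 'v \<Rightarrow> 'v \<Rightarrow> 'v" where
  "adjoint br x y z = br x y z"


section \<open>Power series with coefficients in a module, and deformations\<close>

text \<open>
  \<open>g[[t]]\<close> is the type \<open>'v fps\<close>, on which \<open>k[[t]]\<close> acts by the Cauchy product.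
\<close>

definition fps_scale ::
  "('r::comm_ring_1 \<Rightarrow> 'v::ab_group_add \<Rightarrow> 'v) \<Rightarrow> 'r fps \<Rightarrow> 'v fps \<Rightarrow> 'v fps" where
  "fps_scale s c u = Abs_fps (\<lambda>n. \<Sum>i\<le>n. s (fps_nth c i) (fps_nth u (n - i)))"

text \<open>
  For linear \<open>T : g \<rightarrow> g[[t]]\<close> the \<open>k[[t]]\<close>-linear extension to \<open>g[[t]]\<close> is
  \<open>\<Sum>\<^sub>a t\<^sup>a u\<^sub>a \<mapsto> \<Sum>\<^sub>a t\<^sup>a T(u\<^sub>a)\<close>. It is the only one, since an extension \<open>F\<close> of \<open>T = 0\<close> maps
  \<open>g[[t]] = g + t g + \<dots> + t\<^sup>n g + t\<^sup>n\<^sup>+\<^sup>1 g[[t]]\<close> into \<open>t\<^sup>n\<^sup>+\<^sup>1 g[[t]]\<close> for every \<open>n\<close>.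
  Trilinear maps are extended one argument at a time.
\<close>

definition fps_extend :: "('v \<Rightarrow> 'w fps) \<Rightarrow> 'v::zero fps \<Rightarrow> 'w::ab_group_add fps" where
  "fps_extend T u = Abs_fps (\<lambda>n. \<Sum>a\<le>n. fps_nth (T (fps_nth u a)) (n - a))"

definition fps_extend3 ::
  "('v \<Rightarrow> 'v \<Rightarrow> 'v \<Rightarrow> 'w fps) \<Rightarrow> 'v::zero fps \<Rightarrow> 'v fps \<Rightarrow> 'v fps \<Rightarrow> 'w::ab_group_add fps" where
  "fps_extend3 T u v w =
     fps_extend (\<lambda>x. fps_extend (\<lambda>y. fps_extend (\<lambda>z. T x y z) w) v) u"

definition generates_deformation ::
  "('k::comm_ring_1 \<Rightarrow> 'v::ab_group_add \<Rightarrow> 'v) \<Rightarrow> 'k \<Rightarrow>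
   ('v \<Rightarrow> 'v \<Rightarrow> 'v \<Rightarrow> 'v fps) \<Rightarrow> ('v \<Rightarrow> 'v fps) \<Rightarrow> bool" where
  "generates_deformation scale lam pt phit \<longleftrightarrow>
     differential_three_lie_algebra (fps_scale scale) (fps_extend3 pt) (fps_const lam)
       (fps_extend phit)"

lemma fps_nth_fps_scale:
  "fps_nth (fps_scale s c u) n = (\<Sum>i\<le>n. s (fps_nth c i) (fps_nth u (n - i)))"
  by (simp add: fps_scale_def)

lemma fps_nth_fps_extend:
  "fps_nth (fps_extend T u) n = (\<Sum>a\<le>n. fps_nth (T (fps_nth u a)) (n - a))"
  by (simp add: fps_extend_def)

lemma sum_atMost_only_0:
  assumes "\<And>a. a > 0 \<Longrightarrow> h a = 0"
  shows "(\<Sum>a\<le>n::nat. h a) = (h 0 :: 'a::comm_monoid_add)"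
proof -
  have "(\<Sum>a\<le>n. h a) = (\<Sum>a\<in>{0}. h a)"
    by (rule sum.mono_neutral_right) (use assms in auto)
  then show ?thesis by simp
qed

lemma fps_scale_const_const:
  assumes "module s"
  shows "fps_scale s (fps_const c) (fps_const x) = fps_const (s c x)"
proof -
  interpret module s by fact
  show ?thesis
    by (rule fps_ext, subst fps_nth_fps_scale, subst sum_atMost_only_0) auto
qed

lemma module_fps_scale:
  assumes "module s"
  shows "module (fps_scale s)"
proof -
  interpret module s by fact
  show ?thesis
  proof
    fix a b :: "'a fps" and x y :: "'b fps"
    show "fps_scale s a (x + y) = fps_scale s a x + fps_scale s a y"
      by (rule fps_ext) (simp add: fps_nth_fps_scale scale_right_distrib sum.distrib)
    show "fps_scale s (a + b) x = fps_scale s a x + fps_scale s b x"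
      by (rule fps_ext) (simp add: fps_nth_fps_scale scale_left_distrib sum.distrib)
    show "fps_scale s 1 x = x"
      by (rule fps_ext, subst fps_nth_fps_scale, subst sum_atMost_only_0) auto
    show "fps_scale s a (fps_scale s b x) = fps_scale s (a * b) x"
    proof (rule fps_ext)
      fix n
      have "(\<Sum>j=0..n. \<Sum>i=0..j. s (fps_nth a i * fps_nth b (j - i)) (fps_nth x (n - j))) =
            (\<Sum>j=0..n. \<Sum>i=0..n - j. s (fps_nth a j * fps_nth b i) (fps_nth x (n - j - i)))"
        by (rule fps_mult_assoc_lemma)
      then show "fps_nth (fps_scale s a (fps_scale s b x)) n = fps_nth (fps_scale s (a * b) x) n"
        by (simp add: fps_nth_fps_scale fps_mult_nth scale_sum_left scale_sum_right atMost_atLeast0)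
    qed
  qed
qed

lemma fps_extend_const:
  assumes "T 0 = 0"
  shows "fps_extend T (fps_const x) = T x"
  by (rule fps_ext, subst fps_nth_fps_extend, subst sum_atMost_only_0) (use assms in auto)

lemma fps_extend3_const:
  assumes "\<And>y z. T 0 y z = 0" "\<And>x z. T x 0 z = 0" "\<And>x y. T x y 0 = 0"
  shows "fps_extend3 T (fps_const x) (fps_const y) (fps_const z) = T x y z"
  unfolding fps_extend3_def using assms by (simp add: fps_extend_const)

lemma fps_scale_const_nth:
  assumes "module s"
  shows "fps_nth (fps_scale s (fps_const c) u) n = s c (fps_nth u n)"
proof -
  interpret module s by fact
  show ?thesis
    by (subst fps_nth_fps_scale, subst sum_atMost_only_0) auto
qed

lemma module_hom_fps_extend:
  assumes "module_hom s (\<lambda>c. fps_scale s' (fps_const c)) T" "module s'"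
  shows "module_hom (fps_scale s) (fps_scale s') (fps_extend T)"
proof -
  interpret T: module_hom s "\<lambda>c. fps_scale s' (fps_const c)" T by fact
  interpret s': module s' by fact
  have T_scale: "fps_nth (T (s c x)) n = s' c (fps_nth (T x) n)" for c x n
    by (simp add: T.scale fps_scale_const_nth[OF assms(2)])
  show ?thesis
  proof (intro module_hom.intro module_hom_axioms.intro)
    show "module (fps_scale s)" by (rule module_fps_scale) (rule T.m1.module_axioms)
    show "module (fps_scale s')" by (rule module_fps_scale) fact
    show "fps_extend T (u + v) = fps_extend T u + fps_extend T v" for u v
      by (rule fps_ext) (simp add: fps_nth_fps_extend T.add sum.distrib)
    show "fps_extend T (fps_scale s c u) = fps_scale s' c (fps_extend T u)" for c u
    proof (rule fps_ext)
      fix n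
      have "(\<Sum>j=0..n. \<Sum>i=0..j. s' (fps_nth c i) (fps_nth (T (fps_nth u (j - i))) (n - j))) =
            (\<Sum>j=0..n. \<Sum>i=0..n - j. s' (fps_nth c j) (fps_nth (T (fps_nth u i)) (n - j - i)))"
        by (rule fps_mult_assoc_lemma)
      then show "fps_nth (fps_extend T (fps_scale s c u)) n =
                 fps_nth (fps_scale s' c (fps_extend T u)) n"
        by (simp add: fps_nth_fps_extend fps_nth_fps_scale T.sum fps_sum_nth T_scale
            s'.scale_sum_right atMost_atLeast0)
    qed
  qed
qed

end

theory Submission
  imports Defs
begin

text \<open>
  Both cocycle conditions are the coefficients of \<open>t\<close> in the identities of the deformed structure,
  evaluated at constant power series. The skew-symmetry of the bracket then moves each
  perturbed argument to the last position, where the adjoint representation expects it.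
\<close>

lemma fps_nth_fps_extend_0: "fps_nth (fps_extend T u) 0 = fps_nth (T (fps_nth u 0)) 0"
  by (simp add: fps_nth_fps_extend)

lemma fps_nth_fps_extend_1:
  "fps_nth (fps_extend T u) 1 = fps_nth (T (fps_nth u 0)) 1 + fps_nth (T (fps_nth u 1)) 0"
  by (simp add: fps_nth_fps_extend)

lemma fps_nth_fps_extend3_0:
  "fps_nth (fps_extend3 T u v w) 0 = fps_nth (T (fps_nth u 0) (fps_nth v 0) (fps_nth w 0)) 0"
  by (simp add: fps_extend3_def fps_nth_fps_extend_0)

text \<open>As in the product rule, a single factor \<open>t\<close> comes either from
  \<open>T\<close> itself or from exactly one of the three arguments.\<close>

lemma fps_nth_fps_extend3_1:
  "fps_nth (fps_extend3 T u v w) 1 =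
     fps_nth (T (fps_nth u 0) (fps_nth v 0) (fps_nth w 0)) 1
     + fps_nth (T (fps_nth u 1) (fps_nth v 0) (fps_nth w 0)) 0
     + fps_nth (T (fps_nth u 0) (fps_nth v 1) (fps_nth w 0)) 0
     + fps_nth (T (fps_nth u 0) (fps_nth v 0) (fps_nth w 1)) 0"
  unfolding fps_extend3_def
  by (simp only: fps_nth_fps_extend_0 fps_nth_fps_extend_1 ac_simps)

text \<open>Reads the coefficients off a truncated deformation; \<open>m \<le> N\<close> ensures
  that the summand with \<open>i = m\<close> occurs.\<close>

lemma fps_nth_sum_fps_X_power:
  assumes "module s" and "m \<le> N"
  shows "fps_nth (\<Sum>i = 0..N. fps_scale s (fps_X ^ i) (fps_const (q i))) m = q m"
proof -
  interpret module s by fact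
  have "fps_nth (fps_scale s (fps_X ^ i) (fps_const (q i))) m = (if i = m then q i else 0)" for i
  proof -
    \<comment> \<open>The power \<open>fps_X ^ i\<close> leaves only \<open>j = i\<close>, the
      constant series only \<open>j = m\<close>.\<close>
    have "fps_nth (fps_scale s (fps_X ^ i) (fps_const (q i))) m =
        (\<Sum>j\<le>m. if j = m then (if i = m then q i else 0) else 0)"
      unfolding fps_nth_fps_scale
      by (intro sum.cong) (auto simp: fps_X_power_nth)
    then show ?thesis by simp
  qed
  with \<open>m \<le> N\<close> show ?thesis by (simp add: fps_sum_nth)
qed

context
  fixes s :: "'r::comm_ring_1 \<Rightarrow> 'v::ab_group_add \<Rightarrow> 'v" and s' :: "'r \<Rightarrow> 'w::ab_group_add \<Rightarrow> 'w"
    and f :: "'v \<Rightarrow> 'v \<Rightarrow> 'v \<Rightarrow> 'w"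
  assumes f: "skew_trilinear s s' f"
begin

lemma skew_trilinear_zero: "f 0 y z = 0" "f x 0 z = 0" "f x y 0 = 0"
proof -
  have "module_hom s s' (\<lambda>x. f x y z)" "module_hom s s' (\<lambda>y. f x y z)" "module_hom s s' (f x y)"
    using f unfolding skew_trilinear_def by blast+
  from this[THEN module_hom.zero] show "f 0 y z = 0" "f x 0 z = 0" "f x y 0 = 0" .
qed

text \<open>A 3-cycle is a product of two adjacent transpositions, so the signs cancel.\<close>

lemma skew_trilinear_cyclic: "f y z x = f x y z"
proof -
  have swap: "f b a c = - f a b c" "f a c b = - f a b c" for a b c
    using f unfolding skew_trilinear_def by blast+
  show ?thesis
    by (subst swap(2), subst swap(1)) simp
qed

end

theorem proposition4p1:
  fixes scale :: "'k::field_char_0 \<Rightarrow> 'v::ab_group_add \<Rightarrow> 'v"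
    and br :: "'v \<Rightarrow> 'v \<Rightarrow> 'v \<Rightarrow> 'v" and d :: "'v \<Rightarrow> 'v" and lam :: 'k
    and n :: nat and p :: "nat \<Rightarrow> 'v \<Rightarrow> 'v \<Rightarrow> 'v \<Rightarrow> 'v" and phi :: "nat \<Rightarrow> 'v \<Rightarrow> 'v"
  assumes "vector_space scale"
    and "differential_three_lie_algebra scale br lam d"
    and "n \<ge> 2"
    and "\<And>i. i \<le> n - 1 \<Longrightarrow> skew_trilinear scale scale (p i)"
    and "\<And>i. i \<le> n - 1 \<Longrightarrow> module_hom scale scale (phi i)"
    and "p 0 = br" and "phi 0 = d"
    and "generates_deformation scale lam
           (\<lambda>x y z. \<Sum>i = 0..n - 1. fps_scale scale (fps_X ^ i) (fps_const (p i x y z)))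
           (\<lambda>x. \<Sum>i = 0..n - 1. fps_scale scale (fps_X ^ i) (fps_const (phi i x)))"
  shows "two_cocycle scale br lam d scale (adjoint br) d (p 1, phi 1)"
proof -
  let ?pt = "\<lambda>x y z. \<Sum>i = 0..n - 1. fps_scale scale (fps_X ^ i) (fps_const (p i x y z))"
  let ?phit = "\<lambda>x. \<Sum>i = 0..n - 1. fps_scale scale (fps_X ^ i) (fps_const (phi i x))"
  interpret differential_three_lie_algebra scale br lam d by fact
  interpret dt: differential_three_lie_algebra "fps_scale scale" "fps_extend3 ?pt" "fps_const lam"
    "fps_extend ?phit"
    using assms(8) unfolding generates_deformation_def .
  note zero = skew_trilinear_zero[OF bracket_skew_trilinear]
  note cyclic = skew_trilinear_cyclic[OF bracket_skew_trilinear]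
  \<comment> \<open>This is where \<open>n \<ge> 2\<close> enters: index 1 lies in the summation
    range, so \<open>p 1\<close> and \<open>phi 1\<close> are the coefficients of
    \<open>t\<close>.\<close>
  have "1 \<le> n - 1" using \<open>n \<ge> 2\<close> by simp
  then have p1: "skew_trilinear scale scale (p 1)" and phi1: "module_hom scale scale (phi 1)"
    using assms(4,5) by blast+
  have d_zero: "d 0 = 0" using differential_linear by (rule module_hom.zero)
  have pt: "fps_nth (?pt x y z) 0 = br x y z" "fps_nth (?pt x y z) 1 = p 1 x y z" for x y z
    using \<open>1 \<le> n - 1\<close> by (simp_all only: fps_nth_sum_fps_X_power[OF module_axioms] \<open>p 0 = br\<close> le0)
  have phit: "fps_nth (?phit x) 0 = d x" "fps_nth (?phit x) 1 = phi 1 x" for x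
    using \<open>1 \<le> n - 1\<close> by (simp_all only: fps_nth_sum_fps_X_power[OF module_axioms] \<open>phi 0 = d\<close> le0)
  \<comment> \<open>A constant series has coefficient 0 at \<open>t\<close>; by \<open>zero\<close>
    and \<open>d_zero\<close> the terms that contain it vanish.\<close>
  note coeffs = fps_nth_fps_extend3_0 fps_nth_fps_extend3_1 fps_nth_fps_extend_0
    fps_nth_fps_extend_1 pt phit fps_add_nth fps_scale_const_nth[OF module_axioms]
    fps_nth_fps_const zero_neq_one[symmetric] if_False if_True simp_thms zero d_zero
    add_0_left add_0_right

  \<comment> \<open>In each pair of nested brackets, exactly one is perturbed to \<open>p 1\<close>
    and the other stays \<open>br\<close>.\<close>
  have fundamental:
    "p 1 x1 y1 (br x2 y2 z) + br x1 y1 (p 1 x2 y2 z) =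
       p 1 (br x1 y1 x2) y2 z + br (p 1 x1 y1 x2) y2 z
       + (p 1 x2 (br x1 y1 y2) z + br x2 (p 1 x1 y1 y2) z)
       + (p 1 x2 y2 (br x1 y1 z) + br x2 y2 (p 1 x1 y1 z))" for x1 y1 x2 y2 z
    using arg_cong[OF dt.fundamental_identity[of "fps_const x1" "fps_const y1" "fps_const x2"
          "fps_const y2" "fps_const z"], of "\<lambda>u. fps_nth u 1"]
    by (simp only: coeffs)

  have "coboundary br (adjoint br) (p 1) (x1, y1) (x2, y2) z = 0" for x1 y1 x2 y2 z
    \<comment> \<open>The two rotations yield the last two terms of \<open>coboundary\<close>, where
      the value of \<open>p 1\<close> stands last.\<close>
    using fundamental[of x1 y1 x2 y2 z] cyclic[of y2 z "p 1 x1 y1 x2"]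
      cyclic[of x2 "p 1 x1 y1 y2" z]
    by (simp add: coboundary_def adjoint_def algebra_simps)
  moreover have "coboundary_weighted br d lam scale (adjoint br) (phi 1) x y z
      + delta d lam scale d (p 1) x y z = 0" for x y z
  proof -
    \<comment> \<open>The weight is constant in \<open>t\<close>, so a bracket with m differentiated
      arguments gives 1 + m terms: either the bracket or one of the m differentials is
      perturbed.\<close>
    have "phi 1 (br x y z) + d (p 1 x y z) =
       p 1 (d x) y z + br (phi 1 x) y z + (p 1 x (d y) z + br x (phi 1 y) z)
       + (p 1 x y (d z) + br x y (phi 1 z))
       + scale lam (p 1 (d x) (d y) z + br (phi 1 x) (d y) z + br (d x) (phi 1 y) z)
       + scale lam (p 1 x (d y) (d z) + br x (phi 1 y) (d z) + br x (d y) (phi 1 z))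
       + scale lam (p 1 (d x) y (d z) + br (phi 1 x) y (d z) + br (d x) y (phi 1 z))
       + scale (lam\<^sup>2) (p 1 (d x) (d y) (d z) + br (phi 1 x) (d y) (d z)
           + br (d x) (phi 1 y) (d z) + br (d x) (d y) (phi 1 z))"
      using arg_cong[OF dt.differential_identity[of "fps_const x" "fps_const y" "fps_const z"],
          of "\<lambda>u. fps_nth u 1"]
      by (simp only: coeffs fps_const_power)
    \<comment> \<open>Each \<open>rho_hat\<close> expands into four brackets, one for each choice of
      which of its two arguments get \<open>d\<close>. The eight instances cover those acting on
      \<open>phi 1 x\<close> and \<open>phi 1 y\<close>; \<open>phi 1 z\<close> already stands
      last.\<close>
    moreover have "br b c (phi 1 x) = br (phi 1 x) b c" "br c a (phi 1 y) = br a (phi 1 y) c" for a b c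
      by (rule cyclic cyclic[symmetric])+
    note this(1)[of y z] this(1)[of "d y" z] this(1)[of y "d z"] this(1)[of "d y" "d z"]
      this(2)[of z x] this(2)[of "d z" x] this(2)[of z "d x"] this(2)[of "d z" "d x"]
    ultimately show ?thesis
      \<comment> \<open>Writing \<open>lam\<^sup>2\<close> as a product matches the nested scalings
        by \<open>lam\<close> in \<open>rho_hat\<close>.\<close>
      by (simp add: coboundary_weighted_def delta_def rho_hat_def adjoint_def scale_right_distrib
          power2_eq_square algebra_simps)
  qed
  ultimately show ?thesis
    using p1 phi1 by (auto simp: two_cocycle_def two_cochain_def)
qed

end
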